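(* Let $G$ be a graph on vertices $1,\dots,n$ containing a pair of twin vertices $x$ and $y$ (adjacent or non-adjacent) with $\deg(x)=\deg(y)=d$. Let $$\Lambda=\left\{\sqrt{1-d},\,-\sqrt{1-d}\right\}\ \text{ if } x,y \text{ are non-adjacent},\qquad \Lambda=\left\{\tfrac{-1+\sqrt{5-4d}}{2},\,\tfrac{-1-\sqrt{5-4d}}{2}\right\}\ \text{ if } x,y\text{ are adjacent}.$$ Then for each nonzero $\lambda\in\Lambda$, the vector $\mathbf{v}\in\mathbb{C}^{2n}$ with entries $\mathbf{v}_x=1$, $\mathbf{v}_{n+x}=\frac{-1}{\lambda}$, $\mathbf{v}_y=-1$, $\mathbf{v}_{n+y}=\frac1\lambda$, and $\mathbf{v}_k=\mathbf{v}_{n+k}=0$ for all $1\le k\le n$ with $k\notin\{x,y\}$, is an eigenvector of $K(G)$ for the eigenvalue $\lambda$. Furthermore, if $\mathbf{v}$ is an eigenvector of $K(G)$ for an eigenvalue $\lambda'\notin\Lambda\cup\{0\}$, then $\mathbf{v}_x=\mathbf{v}_y$.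
   Context: All graphs are finite, simple and connected. With $A$ the adjacency matrix and $D$ the diagonal degree matrix of $G$, $K(G)$ is the $2n\times2n$ matrix $\begin{bmatrix} A & D-I_n\\ -I_n & 0\end{bmatrix}$. Two distinct vertices $x,y$ of $G$ are twins if they have the same neighbors among the vertices other than $x$ and $y$; they are adjacent twins if in addition $x$ and $y$ are adjacent, and non-adjacent twins otherwise. Square roots of negative numbers are complex square roots. *)

theory Defs
  imports "Graph_Theory.Graph_Theory" "Jordan_Normal_Form.Char_Poly"
begin

text \<open>
  A finite simple graph is a \<^locale>\<open>pair_graph\<close>: a finite, loop-free, symmetric relation, in
  which an edge \<open>{u, v}\<close> is represented by the two arcs \<open>(u, v)\<close> and \<open>(v, u)\<close>.  Hence the degree of
  a vertex is its \<^const>\<open>out_degree\<close>.  Matrices and vectors of \<open>Jordan_Normal_Form\<close> are indexed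
  from \<open>0\<close>, so the vertices of a graph on \<open>n\<close> vertices are labelled \<open>0, ..., n - 1\<close> (instead of
  \<open>1, ..., n\<close>), and the vertex \<open>k\<close> owns the coordinates \<open>k\<close> and \<open>n + k\<close> of a vector of
  dimension \<open>2 * n\<close>.
\<close>

definition graph_on :: "nat \<Rightarrow> nat pair_pre_digraph \<Rightarrow> bool" where
  "graph_on n G \<longleftrightarrow> pair_graph G \<and> connected (with_proj G) \<and> pverts G = {0..<n}"

definition adjacent :: "'a pair_pre_digraph \<Rightarrow> 'a \<Rightarrow> 'a \<Rightarrow> bool" where
  "adjacent G u v \<longleftrightarrow> (u, v) \<in> parcs G"

definition degree_of :: "'a pair_pre_digraph \<Rightarrow> 'a \<Rightarrow> nat" where
  "degree_of G u = out_degree (with_proj G) u"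

definition twins :: "'a pair_pre_digraph \<Rightarrow> 'a \<Rightarrow> 'a \<Rightarrow> bool" where
  "twins G x y \<longleftrightarrow> x \<in> pverts G \<and> y \<in> pverts G \<and> x \<noteq> y \<and>
     {z \<in> pverts G - {x, y}. adjacent G x z} = {z \<in> pverts G - {x, y}. adjacent G y z}"

definition adjacency_mat :: "nat \<Rightarrow> nat pair_pre_digraph \<Rightarrow> complex mat" where
  "adjacency_mat n G = mat n n (\<lambda>(i, j). if adjacent G i j then 1 else 0)"

definition degree_mat :: "nat \<Rightarrow> nat pair_pre_digraph \<Rightarrow> complex mat" where
  "degree_mat n G = mat n n (\<lambda>(i, j). if i = j then of_nat (degree_of G i) else 0)"

definition K_mat :: "nat \<Rightarrow> nat pair_pre_digraph \<Rightarrow> complex mat" where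
  "K_mat n G = four_block_mat (adjacency_mat n G) (degree_mat n G - 1\<^sub>m n)
                              (- 1\<^sub>m n)            (0\<^sub>m n n)"

text \<open>The set \<open>\<Lambda>\<close>; the flag tells whether the twins are adjacent.\<close>

definition twin_eigenvalues :: "bool \<Rightarrow> nat \<Rightarrow> complex set" where
  "twin_eigenvalues adj d =
     (if adj
      then {(- 1 + csqrt (5 - 4 * of_nat d)) / 2, (- 1 - csqrt (5 - 4 * of_nat d)) / 2}
      else {csqrt (1 - of_nat d), - csqrt (1 - of_nat d)})"

definition twin_vec :: "nat \<Rightarrow> nat \<Rightarrow> nat \<Rightarrow> complex \<Rightarrow> complex vec" where
  "twin_vec n x y l = vec (2 * n) (\<lambda>k.
     if k = x then 1
     else if k = n + x then - 1 / l
     else if k = y then - 1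
     else if k = n + y then 1 / l
     else 0)"

end

theory Submission
  imports Defs
begin

text \<open>
  Write an eigenvector of \<open>K(G)\<close> as \<open>(u, w)\<close> with \<open>u, w \<in> \<complex>\<^sup>n\<close>.  The lower block row
  of the eigenvalue equation says \<open>- u = l w\<close>, and the upper one says
  \<open>A u + (D - I) w = l u\<close>.  The rows of \<open>A\<close> that belong to twins \<open>x\<close> and \<open>y\<close> agree outside the
  columns \<open>x\<close> and \<open>y\<close>.  Hence, with \<open>a = 1\<close> for adjacent twins and \<open>a = 0\<close> for non-adjacent
  ones, subtracting the row of \<open>y\<close> from that of \<open>x\<close> leaves
  \<open>- a (u\<^sub>x - u\<^sub>y) + (d - 1) (w\<^sub>x - w\<^sub>y) = l (u\<^sub>x - u\<^sub>y)\<close>, and multiplying by \<open>l\<close> eliminates \<open>w\<close>: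
  \<open>(l\<^sup>2 + a l + d - 1) (u\<^sub>x - u\<^sub>y) = 0\<close>.

  The quadratic factor vanishes exactly on \<open>\<Lambda>\<close> (lemma \<open>twin_eigenvalues_iff\<close>).  So
  \<open>u\<^sub>x = u\<^sub>y\<close> for every eigenvalue outside \<open>\<Lambda>\<close>.  Conversely, for \<open>u = e\<^sub>x - e\<^sub>y\<close> the lower block
  row forces \<open>w = - u / l\<close>; the entries of \<open>A u\<close> outside \<open>x\<close> and \<open>y\<close> vanish because \<open>A\<close> is
  symmetric and \<open>x\<close>, \<open>y\<close> have the same neighbours there, and the rows of \<open>x\<close>
  and \<open>y\<close> hold precisely when the quadratic factor does vanish.
\<close>

text \<open>
  The two block rows are kept in the form without \<open>1 / l\<close>, so that the equivalence also covers the
  eigenvalue \<open>0\<close>.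
\<close>

lemma eigenvector_K_mat_iff:
  "eigenvector (K_mat n G) v l \<longleftrightarrow>
     v \<in> carrier_vec (2 * n) \<and> v \<noteq> 0\<^sub>v (2 * n) \<and>
     (\<forall>i<n. (\<Sum>j<n. of_bool (adjacent G i j) * v $ j) + (of_nat (degree_of G i) - 1) * v $ (n + i)
              = l * v $ i \<and>
            - v $ i = l * v $ (n + i))"
proof -
  have dim: "dim_row (K_mat n G) = 2 * n"
    by (simp add: K_mat_def adjacency_mat_def mult_2)
  have "K_mat n G *\<^sub>v v = l \<cdot>\<^sub>v v \<longleftrightarrow>
     (\<forall>i<n. (\<Sum>j<n. of_bool (adjacent G i j) * v $ j) + (of_nat (degree_of G i) - 1) * v $ (n + i)
              = l * v $ i \<and>
            - v $ i = l * v $ (n + i))" if v: "v \<in> carrier_vec (2 * n)"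
  proof -
    define u w where "u = vec n (\<lambda>i. v $ i)" and "w = vec n (\<lambda>i. v $ (n + i))"
    have uw: "u \<in> carrier_vec n" "w \<in> carrier_vec n" by (simp_all add: u_def w_def)
    have v_eq: "v = u @\<^sub>v w"
      using v by (intro eq_vecI) (auto simp: u_def w_def)
    have A: "adjacency_mat n G \<in> carrier_mat n n"
      by (simp add: adjacency_mat_def)
    have D: "degree_mat n G - 1\<^sub>m n \<in> carrier_mat n n"
      by (rule minus_carrier_mat) simp
    have K: "K_mat n G *\<^sub>v v =
        (adjacency_mat n G *\<^sub>v u + (degree_mat n G - 1\<^sub>m n) *\<^sub>v w) @\<^sub>v
        ((- 1\<^sub>m n) *\<^sub>v u + 0\<^sub>m n n *\<^sub>v w)"
      unfolding K_mat_def v_eq by (rule four_block_mat_mult_vec[OF A D _ _ uw]) auto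
    have upper: "(adjacency_mat n G *\<^sub>v u + (degree_mat n G - 1\<^sub>m n) *\<^sub>v w) $ i =
        (\<Sum>j<n. of_bool (adjacent G i j) * v $ j) + (of_nat (degree_of G i) - 1) * v $ (n + i)"
      if "i < n" for i
    proof -
      have "((degree_mat n G - 1\<^sub>m n) *\<^sub>v w) $ i =
          (\<Sum>j<n. ((if i = j then of_nat (degree_of G i) else 0) - (if i = j then 1 else 0)) * w $ j)"
        using that uw by (simp add: degree_mat_def scalar_prod_def atLeast0LessThan)
      also have "\<dots> = (\<Sum>j<n. if j = i then (of_nat (degree_of G i) - 1) * w $ i else 0)"
        by (rule sum.cong) auto
      finally have "((degree_mat n G - 1\<^sub>m n) *\<^sub>v w) $ i = (of_nat (degree_of G i) - 1) * w $ i"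
        using that by simp
      moreover have "(adjacency_mat n G *\<^sub>v u) $ i = (\<Sum>j<n. of_bool (adjacent G i j) * v $ j)"
        using that
        by (simp add: adjacency_mat_def u_def scalar_prod_def atLeast0LessThan of_bool_def)
      ultimately show ?thesis
        using that by (simp add: w_def degree_mat_def)
    qed
    have lower: "((- 1\<^sub>m n) *\<^sub>v u + 0\<^sub>m n n *\<^sub>v w) $ i = - v $ i" if "i < n" for i
    proof -
      have "((- 1\<^sub>m n) *\<^sub>v u) $ i = (\<Sum>j<n. if j = i then - u $ i else 0)"
        using that uw by (auto simp: scalar_prod_def atLeast0LessThan intro!: sum.cong)
      then show ?thesis
        using that uw by (simp add: u_def)
    qed
    have lv: "l \<cdot>\<^sub>v v = (l \<cdot>\<^sub>v u) @\<^sub>v (l \<cdot>\<^sub>v w)"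
      unfolding v_eq by (intro eq_vecI) auto
    have "K_mat n G *\<^sub>v v = l \<cdot>\<^sub>v v \<longleftrightarrow>
        adjacency_mat n G *\<^sub>v u + (degree_mat n G - 1\<^sub>m n) *\<^sub>v w = l \<cdot>\<^sub>v u \<and>
        (- 1\<^sub>m n) *\<^sub>v u + 0\<^sub>m n n *\<^sub>v w = l \<cdot>\<^sub>v w"
      unfolding K lv by (rule append_vec_eq) (use uw A D in auto)
    also have "\<dots> \<longleftrightarrow>
        (\<forall>i<n. (adjacency_mat n G *\<^sub>v u + (degree_mat n G - 1\<^sub>m n) *\<^sub>v w) $ i = l * v $ i \<and>
               ((- 1\<^sub>m n) *\<^sub>v u + 0\<^sub>m n n *\<^sub>v w) $ i = l * v $ (n + i))"
      unfolding vec_eq_iff using uw A D by (auto simp: u_def w_def)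
    finally show ?thesis
      by (simp only: upper lower cong: imp_cong)
  qed
  then show ?thesis
    unfolding eigenvector_def dim by blast
qed

lemma adjacent_sym:
  assumes "graph_on n G"
  shows "adjacent G u v \<longleftrightarrow> adjacent G v u"
proof -
  interpret pair_graph G using assms by (simp add: graph_on_def)
  show ?thesis unfolding adjacent_def using arcs_symmetric by blast
qed

lemma not_adjacent_self:
  assumes "graph_on n G"
  shows "\<not> adjacent G u u"
proof -
  interpret pair_graph G using assms by (simp add: graph_on_def)
  show ?thesis unfolding adjacent_def using no_loops' by blast
qed

lemma quadratic_factors:
  fixes l s :: complex
  assumes "s\<^sup>2 = 5 - 4 * c"
  shows "(l - (- 1 + s) / 2) * (l - (- 1 - s) / 2) = l\<^sup>2 + l + c - 1"
proof -
  have "(l - (- 1 + s) / 2) * (l - (- 1 - s) / 2) = l\<^sup>2 + l + (1 - s\<^sup>2) / 4"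
    by (simp add: field_simps power2_eq_square)
  also have "\<dots> = l\<^sup>2 + l + c - 1"
    unfolding assms by (simp add: field_simps)
  finally show ?thesis .
qed

text \<open>\<open>\<Lambda>\<close> is the zero set of the quadratic factor that the twins split off from \<open>K(G)\<close>.\<close>

lemma twin_eigenvalues_iff:
  "l \<in> twin_eigenvalues adj d \<longleftrightarrow> l\<^sup>2 + of_bool adj * l + of_nat d - 1 = 0"
proof (cases adj)
  case True
  let ?s = "csqrt (5 - 4 * of_nat d)"
  have "l\<^sup>2 + l + of_nat d - 1 = (l - (- 1 + ?s) / 2) * (l - (- 1 - ?s) / 2)"
    by (rule quadratic_factors[symmetric]) simp
  then have "l\<^sup>2 + l + of_nat d - 1 = 0 \<longleftrightarrow> l = (- 1 + ?s) / 2 \<or> l = (- 1 - ?s) / 2"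
    by (simp only: mult_eq_0_iff right_minus_eq)
  then show ?thesis
    using True by (simp add: twin_eigenvalues_def)
next
  case False
  have "(l - csqrt (1 - of_nat d)) * (l + csqrt (1 - of_nat d)) = l\<^sup>2 - (csqrt (1 - of_nat d))\<^sup>2"
    by (simp add: algebra_simps power2_eq_square)
  then have "l\<^sup>2 + of_nat d - 1 = (l - csqrt (1 - of_nat d)) * (l + csqrt (1 - of_nat d))"
    by (simp add: algebra_simps)
  then show ?thesis
    using False by (simp add: twin_eigenvalues_def eq_neg_iff_add_eq_0)
qed

text \<open>Subtracting the adjacency rows of twins leaves only the columns of the twins themselves.\<close>

lemma adjacency_rows_of_twins_diff:
  fixes f :: "nat \<Rightarrow> complex"
  assumes "graph_on n G" and "twins G x y"
  shows "(\<Sum>j<n. of_bool (adjacent G x j) * f j) - (\<Sum>j<n. of_bool (adjacent G y j) * f j) =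
    - of_bool (adjacent G x y) * (f x - f y)"
proof -
  have xy: "x < n" "y < n" "x \<noteq> y"
    and same: "\<And>j. j < n \<Longrightarrow> j \<noteq> x \<Longrightarrow> j \<noteq> y \<Longrightarrow> adjacent G x j = adjacent G y j"
    using assms by (auto simp: graph_on_def twins_def)
  let ?g = "\<lambda>j. (of_bool (adjacent G x j) - of_bool (adjacent G y j)) * f j"
  have "(\<Sum>j<n. of_bool (adjacent G x j) * f j) - (\<Sum>j<n. of_bool (adjacent G y j) * f j) =
      (\<Sum>j<n. ?g j)"
    by (simp add: sum_subtractf left_diff_distrib)
  also have "\<dots> = (\<Sum>j\<in>{x, y}. ?g j)"
    by (rule sum.mono_neutral_right) (use xy same in auto)
  also have "\<dots> = - of_bool (adjacent G x y) * (f x - f y)"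
    using xy adjacent_sym[OF assms(1), of y x] not_adjacent_self[OF assms(1)]
    by (simp add: algebra_simps)
  finally show ?thesis .
qed

text \<open>
  A vertex other than \<open>x\<close> and \<open>y\<close> sees both twins or neither, so the entries \<open>1\<close> and \<open>- 1\<close> cancel
  in its row; the rows of the twins are the quadratic equation divided by \<open>\<plusminus> l\<close>.
\<close>

lemma twin_vec_eigenvector:
  assumes G: "graph_on n G" and tw: "twins G x y"
    and deg: "degree_of G x = d" "degree_of G y = d"
    and root: "l\<^sup>2 + of_bool (adjacent G x y) * l + of_nat d - 1 = 0" and l: "l \<noteq> 0"
  shows "eigenvector (K_mat n G) (twin_vec n x y l) l"
proof -
  let ?v = "twin_vec n x y l"
  have xy: "x < n" "y < n" "x \<noteq> y"
    and same: "\<And>i. i < n \<Longrightarrow> i \<noteq> x \<Longrightarrow> i \<noteq> y \<Longrightarrow> adjacent G x i = adjacent G y i"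
    using G tw by (auto simp: graph_on_def twins_def)
  have v1: "?v $ i = (if i = x then 1 else if i = y then - 1 else 0)"
    and v2: "?v $ (n + i) = - (?v $ i) / l" if "i < n" for i
    using that xy by (auto simp: twin_vec_def)
  have row: "(\<Sum>j<n. of_bool (adjacent G i j) * ?v $ j) =
      of_bool (adjacent G i x) - of_bool (adjacent G i y)" for i
  proof -
    have "(\<Sum>j<n. of_bool (adjacent G i j) * ?v $ j) =
        (\<Sum>j\<in>{x, y}. of_bool (adjacent G i j) * ?v $ j)"
      by (rule sum.mono_neutral_right) (use xy v1 in auto)
    then show ?thesis using xy by (simp add: v1)
  qed
  \<comment> \<open>The quadratic equation divided by \<open>l\<close>: this is the row of \<open>x\<close>, and up to sign that of \<open>y\<close>.\<close>
  have root': "- of_bool (adjacent G x y) - (of_nat d - 1) / l = l"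
    using root l by (simp add: field_simps power2_eq_square)
  have "(\<Sum>j<n. of_bool (adjacent G i j) * ?v $ j) + (of_nat (degree_of G i) - 1) * ?v $ (n + i)
      = l * ?v $ i" if i: "i < n" for i
  proof -
    consider "i = x" | "i = y" | "i \<noteq> x" "i \<noteq> y" by blast
    then show ?thesis
    proof cases
      case 1
      then show ?thesis
        unfolding row v2[OF i] using root' i deg
        by (simp add: v1 not_adjacent_self[OF G])
    next
      case 2
      then show ?thesis
        unfolding row v2[OF i] using arg_cong[OF root', of uminus] i deg xy
        by (cases "adjacent G x y")
          (simp_all add: v1 not_adjacent_self[OF G] adjacent_sym[OF G, of y x] add.commute)
    next
      case 3
      then show ?thesis
        unfolding row v2[OF i] using same[OF i] i
        by (simp add: v1 adjacent_sym[OF G, of i])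
    qed
  qed
  moreover have "- ?v $ i = l * ?v $ (n + i)" if "i < n" for i
    unfolding v2[OF that] using l by simp
  moreover have "?v \<noteq> 0\<^sub>v (2 * n)"
  proof
    assume "?v = 0\<^sub>v (2 * n)"
    then have "?v $ x = 0" using xy by simp
    then show False using xy by (simp add: v1)
  qed
  ultimately show ?thesis
    unfolding eigenvector_K_mat_iff by (simp add: twin_vec_def)
qed

text \<open>
  The lower block row turns \<open>l\<close> times the difference of the upper rows of \<open>x\<close> and \<open>y\<close> into an
  equation in \<open>v $ x - v $ y\<close> alone.
\<close>

lemma eigenvector_twin_entries:
  assumes G: "graph_on n G" and tw: "twins G x y"
    and deg: "degree_of G x = d" "degree_of G y = d"
    and ev: "eigenvector (K_mat n G) v l"
  shows "(l\<^sup>2 + of_bool (adjacent G x y) * l + of_nat d - 1) * (v $ x - v $ y) = 0"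
proof -
  have xy: "x < n" "y < n"
    using G tw by (auto simp: graph_on_def twins_def)
  let ?a = "of_bool (adjacent G x y) :: complex"
  let ?c = "of_nat d - 1 :: complex"
  let ?A = "\<lambda>i. \<Sum>j<n. of_bool (adjacent G i j) * v $ j"
  have up: "?A x + ?c * v $ (n + x) = l * v $ x" "?A y + ?c * v $ (n + y) = l * v $ y"
    and low: "- v $ x = l * v $ (n + x)" "- v $ y = l * v $ (n + y)"
    using ev xy deg unfolding eigenvector_K_mat_iff by auto
  have "l * (v $ x - v $ y) = (?A x - ?A y) + ?c * (v $ (n + x) - v $ (n + y))"
    unfolding right_diff_distrib up[symmetric] by simp
  also have "?A x - ?A y = - ?a * (v $ x - v $ y)"
    by (rule adjacency_rows_of_twins_diff[OF G tw])
  finally have diff: "l * (v $ x - v $ y) + ?a * (v $ x - v $ y) = ?c * (v $ (n + x) - v $ (n + y))"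
    by simp
  have "(l\<^sup>2 + ?a * l + of_nat d - 1) * (v $ x - v $ y) =
      l * (l * (v $ x - v $ y) + ?a * (v $ x - v $ y)) + ?c * (v $ x - v $ y)"
    by (simp add: algebra_simps power2_eq_square)
  also have "\<dots> = ?c * (l * v $ (n + x) - l * v $ (n + y) + v $ x - v $ y)"
    unfolding diff by (simp add: algebra_simps)
  also have "\<dots> = 0"
    unfolding low[symmetric] by simp
  finally show ?thesis .
qed

theorem proposition3p4:
  fixes n d x y :: nat and G :: "nat pair_pre_digraph" and \<Lambda> :: "complex set"
  assumes "graph_on n G"
    and "twins G x y"
    and "degree_of G x = d" and "degree_of G y = d"
    and "\<Lambda> = twin_eigenvalues (adjacent G x y) d"
  shows "(\<forall>l \<in> \<Lambda>. l \<noteq> 0 \<longrightarrow> eigenvector (K_mat n G) (twin_vec n x y l) l) \<and>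
    (\<forall>l' v. eigenvector (K_mat n G) v l' \<and> l' \<notin> \<Lambda> \<union> {0} \<longrightarrow> v $ x = v $ y)"
proof (intro conjI ballI allI impI)
  fix l assume "l \<in> \<Lambda>" and "l \<noteq> 0"
  then show "eigenvector (K_mat n G) (twin_vec n x y l) l"
    using twin_vec_eigenvector[OF assms(1-4)] by (simp add: assms(5) twin_eigenvalues_iff)
next
  fix l' v assume "eigenvector (K_mat n G) v l' \<and> l' \<notin> \<Lambda> \<union> {0}"
  then show "v $ x = v $ y"
    using eigenvector_twin_entries[OF assms(1-4), of v l']
    by (auto simp: assms(5) twin_eigenvalues_iff)
qed

end
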